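(* Suppose that for every $t\in\{1,\dots,T\}$ the meta-loss $\lambda\mapsto\mathcal{L}_t(\lambda)$ is $L$-Lipschitz and convex. Let $\alpha>0$ and $\lambda_1\in\Lambda$, and let the tuning parameters $\lambda_2,\dots,\lambda_T$ be produced either by OGMS or by OPMS with step $\alpha$ and starting point $\lambda_1$. Then $$\sum_{t=1}^T \sum_{i=1}^n \ell_{t,i}(\theta_{t,i}^{\lambda_t}) \leq \inf_{\lambda\in\Lambda} \left\{ \sum_{t=1}^T \mathcal{L}_t(\lambda) + \frac{\alpha TL^2}{2} + \frac{\|\lambda-\lambda_1\|^2}{2\alpha} \right\}.$$
   Context: Setting. $T,n\ge 1$ are integers, $\Theta\subseteq\mathbb{R}^d$ is a decision space, $\Lambda\subseteq\mathbb{R}^p$ is closed and convex, and $\|\cdot\|$ is the Euclidean norm. For each task $t\in\{1,\dots,T\}$ and round $i\in\{1,\dots,n\}$ there is a convex loss function $\ell_{t,i}:\Theta\to\mathbb{R}$. A within-task online strategy with tuning parameter $\lambda\in\Lambda$ (kept fixed during a task) produces decisions $\theta_{t,i}^{\lambda}\in\Theta$. It is assumed that there are a set $\Theta_0\subset\Theta$ and a known function $\mathcal{B}_n:\Theta\times\Lambda\to\mathbb{R}$ such that for every task $t$ and every $\lambda\in\Lambda$, $$\sum_{i=1}^n \ell_{t,i}(\theta_{t,i}^\lambda)\le \mathcal{L}_t(\lambda):=\inf_{\theta\in\Theta_0}\Big\{\sum_{i=1}^n\ell_{t,i}(\theta)+\mathcal{B}_n(\theta,\lambda)\Big\}.$$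 The function $\mathcal{L}_t:\Lambda\to\mathbb{R}$ is called the meta-loss. OGMS (online gradient meta-strategy) with step $\alpha>0$ and starting point $\lambda_1\in\Lambda$: for $t>1$, $\lambda_t=\Pi_\Lambda[\lambda_{t-1}-\alpha\nabla\mathcal{L}_{t-1}(\lambda_{t-1})]$, where $\Pi_\Lambda$ is the orthogonal projection on $\Lambda$ and $\nabla\mathcal{L}_{t}(\lambda)$ denotes any element of the subdifferential of the convex function $\mathcal{L}_t$ at $\lambda$. OPMS (online proximal meta-strategy) with step $\alpha>0$ and starting point $\lambda_1\in\Lambda$: for $t>1$, $\lambda_t=\operatorname{argmin}_{\lambda\in\Lambda}\big\{\mathcal{L}_{t-1}(\lambda)+\frac{\|\lambda-\lambda_{t-1}\|^2}{2\alpha}\big\}$.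
   Formalization: For OGMS, the subgradient chosen at any λ_t (t<T) on the relative boundary of Λ is additionally required to have norm at most L; without this the bound can fail, e.g. Λ=[0,∞), 𝓛_t(λ)=λ, λ_1=0 with subgradient −1000. *)

theory Defs
  imports "HOL-Analysis.Analysis"
begin

text \<open>
  Library \<open>convex_on S f\<close> includes \<open>convex S\<close>. The decision space is not assumed convex, so a
  convex function \<open>S \<rightarrow> \<real>\<close> is required to satisfy the convexity inequality whenever the
  convex combination lies in \<open>S\<close>; for convex \<open>S\<close> this is \<open>convex_on\<close>.
\<close>

definition convex_fun_on :: "'a::real_vector set \<Rightarrow> ('a \<Rightarrow> real) \<Rightarrow> bool" where
  "convex_fun_on S f \<longleftrightarrow>
     (\<forall>x\<in>S. \<forall>y\<in>S. \<forall>u\<ge>0. \<forall>v\<ge>0. u + v = 1 \<longrightarrow> u *\<^sub>R x + v *\<^sub>R y \<in> S \<longrightarrow>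
        f (u *\<^sub>R x + v *\<^sub>R y) \<le> u * f x + v * f y)"

lemma convex_fun_on_iff_convex_on:
  assumes "convex S"
  shows "convex_fun_on S f \<longleftrightarrow> convex_on S f"
  using assms unfolding convex_fun_on_def convex_on_def convex_def by blast

text \<open>
  \<open>loss t i\<close> is the loss of task \<open>t\<close> at round \<open>i\<close>. The infimum is taken in the
  reals, so it is meaningful only if \<open>\<Theta>0\<close> is nonempty and the objective is bounded below on it.
\<close>

definition meta_loss ::
  "(nat \<Rightarrow> nat \<Rightarrow> 'd \<Rightarrow> real) \<Rightarrow> ('d \<Rightarrow> 'p \<Rightarrow> real) \<Rightarrow> 'd set \<Rightarrow> nat \<Rightarrow> nat \<Rightarrow> 'p \<Rightarrow> real" where
  "meta_loss loss B \<Theta>0 n t lam = (INF \<theta>\<in>\<Theta>0. (\<Sum>i=1..n. loss t i \<theta>) + B \<theta> lam)"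

text \<open>
  Subdifferential at \<open>x\<close> of \<open>f : S \<rightarrow> \<real>\<close>, that is, of \<open>f\<close> extended by \<open>+\<infinity>\<close> outside \<open>S\<close>;
  adding a normal vector of \<open>S\<close> at \<open>x\<close> to a subgradient gives a subgradient, so at relative
  boundary points of \<open>S\<close> an \<open>L\<close>-Lipschitz \<open>f\<close> also has subgradients of norm greater than \<open>L\<close>.
\<close>

definition subdifferential :: "'a::real_inner set \<Rightarrow> ('a \<Rightarrow> real) \<Rightarrow> 'a \<Rightarrow> 'a set" where
  "subdifferential S f x = {g. \<forall>y\<in>S. f x + g \<bullet> (y - x) \<le> f y}"

text \<open>
  \<open>F t\<close> is the meta-loss of task \<open>t\<close>, \<open>g t\<close> the subgradient chosen after task \<open>t\<close>, and
  \<open>l t\<close> the tuning parameter used in task \<open>t\<close>; only the indices \<open>1, \<dots>, T\<close> matter.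
\<close>

definition OGMS ::
  "('p::euclidean_space) set \<Rightarrow> real \<Rightarrow> nat \<Rightarrow> (nat \<Rightarrow> 'p \<Rightarrow> real) \<Rightarrow> (nat \<Rightarrow> 'p) \<Rightarrow> 'p \<Rightarrow> (nat \<Rightarrow> 'p) \<Rightarrow> bool" where
  "OGMS \<Lambda> \<alpha> T F g l1 l \<longleftrightarrow>
     l 1 = l1 \<and>
     (\<forall>t\<in>{2..T}. g (t - 1) \<in> subdifferential \<Lambda> (F (t - 1)) (l (t - 1)) \<and>
        l t = closest_point \<Lambda> (l (t - 1) - \<alpha> *\<^sub>R g (t - 1)))"

definition OPMS ::
  "('p::euclidean_space) set \<Rightarrow> real \<Rightarrow> nat \<Rightarrow> (nat \<Rightarrow> 'p \<Rightarrow> real) \<Rightarrow> 'p \<Rightarrow> (nat \<Rightarrow> 'p) \<Rightarrow> bool" where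
  "OPMS \<Lambda> \<alpha> T F l1 l \<longleftrightarrow>
     l 1 = l1 \<and>
     (\<forall>t\<in>{2..T}.
        is_arg_min (\<lambda>x. F (t - 1) x + (norm (x - l (t - 1)))\<^sup>2 / (2 * \<alpha>)) (\<lambda>x. x \<in> \<Lambda>) (l t))"

end

theory Submission
  imports Defs
begin

text \<open>
  Both strategies satisfy, for every comparator \<open>u\<close>, the one-step inequality
  \<open>f x - f u \<le> \<alpha> L\<^sup>2 / 2 + (\<parallel>u - x\<parallel>\<^sup>2 - \<parallel>u - y\<parallel>\<^sup>2) / (2 \<alpha>)\<close>, where \<open>y\<close> is the iterate following \<open>x\<close>;
  it telescopes. For the gradient step it follows from the variational inequality of the
  projection, which only sees the component of the subgradient along the affine hull of the
  domain; at relative interior points this component has norm at most \<open>L\<close>. For the proximal step it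
  follows from strong convexity of the proximal objective. No iterate follows the last one, and
  there the Lipschitz property alone gives the inequality without its negative term.
\<close>

section \<open>Elementary inequalities\<close>

text \<open>Young's inequality: the difference of the two sides is a square. It turns a Lipschitz
  bound into the terms of the one-step inequality.\<close>

lemma linear_le_quadratic:
  fixes L d \<alpha> :: real
  assumes "\<alpha> > 0"
  shows "L * d \<le> \<alpha> * L\<^sup>2 / 2 + d\<^sup>2 / (2 * \<alpha>)"
proof -
  have "\<alpha> * L\<^sup>2 / 2 + d\<^sup>2 / (2 * \<alpha>) - L * d = (\<alpha> * L - d)\<^sup>2 / (2 * \<alpha>)"
    using assms by (simp add: field_simps power2_eq_square)
  also have "\<dots> \<ge> 0"
    using assms by simp
  finally show ?thesis
    by simp
qed

lemma lipschitz_on_diff_le: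
  assumes "L-lipschitz_on S f" "x \<in> S" "y \<in> S"
  shows "f x - f y \<le> L * norm (x - y)"
  using lipschitz_onD[OF assms] by (simp add: dist_norm)

text \<open>Let \<open>s\<close> tend to 0 from the right. This extracts a first-order condition
  from a minimum without differentiating the objective.\<close>

lemma le_of_le_add_scaled:
  fixes a b c :: real
  assumes "\<And>s. 0 < s \<Longrightarrow> s \<le> 1 \<Longrightarrow> a \<le> b + s * c"
  shows "a \<le> b"
proof (rule tendsto_lowerbound)
  show "((\<lambda>s. b + s * c) \<longlongrightarrow> b) (at_right 0)"
    by (auto intro!: tendsto_eq_intros)
  show "\<forall>\<^sub>F s in at_right 0. a \<le> b + s * c"
    using eventually_at_right_real[OF zero_less_one]
    by eventually_elim (use assms in auto)
qed simp

section \<open>The projected subgradient step\<close>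

text \<open>Take for \<open>g'\<close> the orthogonal projection of \<open>g\<close> on the
  direction space of the affine hull; the remainder is orthogonal to all differences of points of
  \<open>S\<close>. A short move from \<open>x\<close> along \<open>g'\<close> stays in
  \<open>S\<close>, and there the growth of \<open>f\<close> is at least that given by
  \<open>g'\<close> and at most that given by \<open>L\<close>.\<close>

lemma rel_interior_subgradient_along_affine_hull:
  fixes x g :: "'a::euclidean_space"
  assumes "x \<in> rel_interior S" "g \<in> subdifferential S f x" "L-lipschitz_on S f"
  obtains g' where "\<And>u v. u \<in> S \<Longrightarrow> v \<in> S \<Longrightarrow> g' \<bullet> (u - v) = g \<bullet> (u - v)" "norm g' \<le> L"
proof -
  obtain e where "x \<in> S" "e > 0" and e: "cball x e \<inter> affine hull S \<subseteq> S"
    using assms(1) by (auto simp: mem_rel_interior_cball)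
  define D where "D = span ((\<lambda>y. - x + y) ` S)"
  obtain g' h where g': "g' \<in> D" and h: "\<And>w. w \<in> D \<Longrightarrow> orthogonal h w" and g: "g = g' + h"
    using orthogonal_subspace_decomp_exists[of "(\<lambda>y. - x + y) ` S" g] unfolding D_def by metis
  have along: "g' \<bullet> (u - v) = g \<bullet> (u - v)" if "u \<in> S" "v \<in> S" for u v
  proof -
    have "(- x + u) - (- x + v) \<in> D"
      unfolding D_def using that by (intro span_diff span_base imageI)
    then show ?thesis
      using h[of "u - v"] by (simp add: g orthogonal_def inner_add_left)
  qed
  have "norm g' \<le> L"
  proof (cases "g' = 0")
    case True
    then show ?thesis
      using lipschitz_on_nonneg[OF assms(3)] by simp
  next
    case False
    \<comment> \<open>The scaling makes the displacement \<open>c *\<^sub>R g'\<close> exactly as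
      long as the radius \<open>e\<close>.\<close>
    define c where "c = e / norm g'"
    have c: "c > 0" "c * norm g' = e"
      using False \<open>e > 0\<close> by (auto simp: c_def)
    have "x \<in> affine hull S"
      using \<open>x \<in> S\<close> by (rule hull_inc)
    have "c *\<^sub>R g' \<in> D"
      using g' unfolding D_def by (rule span_scale)
    then have "x + c *\<^sub>R g' \<in> affine hull S"
      unfolding D_def affine_hull_span_gen[OF \<open>x \<in> affine hull S\<close>] by (rule imageI)
    moreover have "x + c *\<^sub>R g' \<in> cball x e"
      using c by (simp add: dist_norm)
    ultimately have in_S: "x + c *\<^sub>R g' \<in> S"
      using e by blast
    have "norm g' * (c * norm g') = g' \<bullet> (c *\<^sub>R g')"
      by (simp add: dot_square_norm power2_eq_square)
    also have "\<dots> = g \<bullet> (c *\<^sub>R g')"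
      using along[OF in_S \<open>x \<in> S\<close>] by simp
    also have "\<dots> \<le> f (x + c *\<^sub>R g') - f x"
      using assms(2) in_S unfolding subdifferential_def by force
    also have "\<dots> \<le> L * (c * norm g')"
      using lipschitz_on_diff_le[OF assms(3) in_S \<open>x \<in> S\<close>] c by simp
    finally show ?thesis
      using c \<open>e > 0\<close> by simp
  qed
  with along that show thesis
    by blast
qed

text \<open>The usual expansion of the squared distance to \<open>u\<close>, carried out with a
  vector \<open>g'\<close> of norm at most \<open>L\<close> that acts like \<open>g\<close> on
  differences of points of \<open>S\<close>. On the relative frontier \<open>g\<close> itself
  serves, which is what \<open>bound\<close> is for.\<close>

lemma projected_subgradient_step:
  fixes x g u :: "'a::euclidean_space"
  assumes "closed S" "convex S" "\<alpha> > 0" "x \<in> S" "u \<in> S"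
    and lip: "L-lipschitz_on S f"
    and g: "g \<in> subdifferential S f x"
    and bound: "x \<in> rel_frontier S \<Longrightarrow> norm g \<le> L"
    and y: "y = closest_point S (x - \<alpha> *\<^sub>R g)"
  shows "f x - f u \<le> \<alpha> * L\<^sup>2 / 2 + ((norm (u - x))\<^sup>2 - (norm (u - y))\<^sup>2) / (2 * \<alpha>)"
proof -
  have "y \<in> S"
    using assms(1,4) unfolding y by (auto intro: closest_point_in_set)
  obtain g' where g': "\<And>u v. u \<in> S \<Longrightarrow> v \<in> S \<Longrightarrow> g' \<bullet> (u - v) = g \<bullet> (u - v)" "norm g' \<le> L"
  proof (cases "x \<in> rel_frontier S")
    case True
    then show thesis
      using bound that[of g] by simp
  next
    case False
    then have "x \<in> rel_interior S"
      using \<open>x \<in> S\<close> closure_subset by (auto simp: rel_frontier_def)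
    then show thesis
      using rel_interior_subgradient_along_affine_hull[OF _ g lip] that by blast
  qed
  have "(x - \<alpha> *\<^sub>R g - y) \<bullet> (u - y) \<le> 0"
    unfolding y using assms by (intro closest_point_dot)
  \<comment> \<open>Since \<open>u - y\<close> is a difference of points of \<open>S\<close>,
    replacing \<open>g\<close> by \<open>g'\<close> leaves the variational inequality
    intact.\<close>
  then have "(x - \<alpha> *\<^sub>R g' - y) \<bullet> (u - y) \<le> 0"
    using g'(1)[OF \<open>u \<in> S\<close> \<open>y \<in> S\<close>] by (simp add: inner_diff_left)
  \<comment> \<open>The angle at \<open>y\<close> between \<open>u\<close> and
    \<open>x - \<alpha> *\<^sub>R g'\<close> is not acute, so Pythagoras holds as an
    inequality.\<close>
  then have "(norm (u - y))\<^sup>2 \<le> (norm (u - (x - \<alpha> *\<^sub>R g')))\<^sup>2 - (norm (x - \<alpha> *\<^sub>R g' - y))\<^sup>2"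
    by (simp add: power2_norm_eq_inner inner_diff_left inner_diff_right inner_commute algebra_simps)
  also have "\<dots> \<le> (norm ((u - x) + \<alpha> *\<^sub>R g'))\<^sup>2"
    by (simp add: algebra_simps)
  also have "\<dots> = (norm (u - x))\<^sup>2 + 2 * \<alpha> * (g' \<bullet> (u - x)) + \<alpha>\<^sup>2 * (norm g')\<^sup>2"
    by (simp only: power2_norm_eq_inner inner_add_left inner_add_right inner_scaleR_left
        inner_scaleR_right) (simp add: inner_commute power2_eq_square algebra_simps)
  also have "\<dots> \<le> (norm (u - x))\<^sup>2 + 2 * \<alpha> * (f u - f x) + \<alpha>\<^sup>2 * L\<^sup>2"
  proof -
    have "g' \<bullet> (u - x) \<le> f u - f x"
      using g g'(1)[OF \<open>u \<in> S\<close> \<open>x \<in> S\<close>] \<open>u \<in> S\<close> unfolding subdifferential_def by force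
    moreover have "(norm g')\<^sup>2 \<le> L\<^sup>2"
      using g'(2) by (intro power_mono) auto
    ultimately show ?thesis
      using \<open>\<alpha> > 0\<close> by (intro add_mono mult_left_mono) auto
  qed
  finally show ?thesis
    using \<open>\<alpha> > 0\<close> by (simp add: field_simps power2_eq_square)
qed

section \<open>The proximal step\<close>

text \<open>The quadratic term makes the objective strongly convex, so its value at \<open>u\<close>
  exceeds the minimum by a multiple of the squared distance to \<open>y\<close>. The proof compares
  \<open>y\<close> with points of the segment towards \<open>u\<close> and lets them approach
  \<open>y\<close>.\<close>

lemma proximal_point_inequality:
  fixes x y u :: "'a::real_inner"
  assumes "convex_on S f" "\<alpha> > 0" "u \<in> S"
    and min: "is_arg_min (\<lambda>z. f z + (norm (z - x))\<^sup>2 / (2 * \<alpha>)) (\<lambda>z. z \<in> S) y"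
  shows "f y + (norm (y - x))\<^sup>2 / (2 * \<alpha>) + (norm (u - y))\<^sup>2 / (2 * \<alpha>)
    \<le> f u + (norm (u - x))\<^sup>2 / (2 * \<alpha>)"
proof -
  have "y \<in> S"
    using min by (simp add: is_arg_min_def)
  have "2 * \<alpha> * (f y - f u) \<le> 2 * ((y - x) \<bullet> (u - y))"
  proof (rule le_of_le_add_scaled)
    fix s :: real
    assume s: "0 < s" "s \<le> 1"
    define w where "w = (1 - s) *\<^sub>R y + s *\<^sub>R u"
    have "w \<in> S"
      using convexD_alt[OF convex_on_imp_convex[OF assms(1)] \<open>y \<in> S\<close> \<open>u \<in> S\<close>] s
      by (simp add: w_def)
    then have "f y + (norm (y - x))\<^sup>2 / (2 * \<alpha>) \<le> f w + (norm (w - x))\<^sup>2 / (2 * \<alpha>)"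
      using min by (auto simp: is_arg_min_linorder)
    moreover have "f w \<le> (1 - s) * f y + s * f u"
      using convex_onD[OF assms(1), of s y u] s \<open>y \<in> S\<close> \<open>u \<in> S\<close> by (simp add: w_def)
    ultimately have "s * (f y - f u) \<le> ((norm (w - x))\<^sup>2 - (norm (y - x))\<^sup>2) / (2 * \<alpha>)"
      by (simp add: diff_divide_distrib algebra_simps)
    then have "2 * \<alpha> * s * (f y - f u) \<le> (norm (w - x))\<^sup>2 - (norm (y - x))\<^sup>2"
      using \<open>\<alpha> > 0\<close> by (simp add: pos_le_divide_eq ac_simps)
    also have "w - x = (y - x) + s *\<^sub>R (u - y)"
      by (simp add: w_def algebra_simps)
    also have "(norm \<dots>)\<^sup>2 - (norm (y - x))\<^sup>2
      = s * (2 * ((y - x) \<bullet> (u - y)) + s * (norm (u - y))\<^sup>2)"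
      by (simp only: power2_norm_eq_inner inner_add_left inner_add_right inner_scaleR_left
          inner_scaleR_right) (simp add: inner_commute algebra_simps)
    finally have "s * (2 * \<alpha> * (f y - f u)) \<le> s * (2 * ((y - x) \<bullet> (u - y)) + s * (norm (u - y))\<^sup>2)"
      by (simp add: ac_simps)
    then show "2 * \<alpha> * (f y - f u) \<le> 2 * ((y - x) \<bullet> (u - y)) + s * (norm (u - y))\<^sup>2"
      using s(1) by (rule mult_left_le_imp_le)
  qed
  \<comment> \<open>Polarization of \<open>u - x = (u - y) + (y - x)\<close>.\<close>
  also have "\<dots> = (norm (u - x))\<^sup>2 - (norm (y - x))\<^sup>2 - (norm (u - y))\<^sup>2"
    by (simp add: power2_norm_eq_inner inner_diff_left inner_diff_right inner_commute algebra_simps)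
  finally have "f y - f u \<le> ((norm (u - x))\<^sup>2 - (norm (y - x))\<^sup>2 - (norm (u - y))\<^sup>2) / (2 * \<alpha>)"
    using \<open>\<alpha> > 0\<close> by (simp add: pos_le_divide_eq ac_simps)
  then show ?thesis
    by (simp add: diff_divide_distrib)
qed

text \<open>The Lipschitz property pays for the passage from \<open>f x\<close> to
  \<open>f y\<close>; the squared distance from \<open>x\<close> to \<open>y\<close> that Young's
  inequality leaves cancels against the one in the proximal inequality.\<close>

lemma proximal_step:
  fixes x y u :: "'a::real_inner"
  assumes "convex_on S f" "\<alpha> > 0" "x \<in> S" "u \<in> S"
    and lip: "L-lipschitz_on S f"
    and min: "is_arg_min (\<lambda>z. f z + (norm (z - x))\<^sup>2 / (2 * \<alpha>)) (\<lambda>z. z \<in> S) y"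
  shows "f x - f u \<le> \<alpha> * L\<^sup>2 / 2 + ((norm (u - x))\<^sup>2 - (norm (u - y))\<^sup>2) / (2 * \<alpha>)"
proof -
  have "y \<in> S"
    using min by (simp add: is_arg_min_def)
  then have "f x - f y \<le> L * norm (y - x)"
    using lipschitz_on_diff_le[OF lip \<open>x \<in> S\<close>] by (metis norm_minus_commute)
  also have "\<dots> \<le> \<alpha> * L\<^sup>2 / 2 + (norm (y - x))\<^sup>2 / (2 * \<alpha>)"
    using \<open>\<alpha> > 0\<close> by (rule linear_le_quadratic)
  finally show ?thesis
    using proximal_point_inequality[OF assms(1,2,4) min] by (simp add: diff_divide_distrib)
qed

section \<open>The iterates of the two strategies\<close>

lemma OGMS_in_domain:
  assumes "OGMS S \<alpha> T F g l1 l" "closed S" "l1 \<in> S" "t \<in> {1..T}"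
  shows "l t \<in> S"
proof (cases "t = 1")
  case False
  with assms have "l t = closest_point S (l (t - 1) - \<alpha> *\<^sub>R g (t - 1))"
    unfolding OGMS_def by auto
  then show ?thesis
    using assms(2,3) by (auto intro: closest_point_in_set)
qed (use assms in \<open>simp add: OGMS_def\<close>)

lemma OPMS_in_domain:
  assumes "OPMS S \<alpha> T F l1 l" "l1 \<in> S" "t \<in> {1..T}"
  shows "l t \<in> S"
proof (cases "t = 1")
  case False
  with assms show ?thesis
    unfolding OPMS_def is_arg_min_def by auto
qed (use assms in \<open>simp add: OPMS_def\<close>)

lemma OGMS_step:
  assumes "OGMS S \<alpha> T F g l1 l" "closed S" "convex S" "\<alpha> > 0" "l1 \<in> S" "u \<in> S"
    and "t \<in> {1..<T}" "L-lipschitz_on S (F t)" "l t \<in> rel_frontier S \<Longrightarrow> norm (g t) \<le> L"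
  shows "F t (l t) - F t u
    \<le> \<alpha> * L\<^sup>2 / 2 + ((norm (u - l t))\<^sup>2 - (norm (u - l (Suc t)))\<^sup>2) / (2 * \<alpha>)"
proof -
  \<comment> \<open>The definition indexes an update by the new iterate, so the step out of
    \<open>l t\<close> is its instance at \<open>Suc t\<close>.\<close>
  have "Suc t \<in> {2..T}"
    using assms(7) by auto
  then have "g t \<in> subdifferential S (F t) (l t)"
    and "l (Suc t) = closest_point S (l t - \<alpha> *\<^sub>R g t)"
    using assms(1) unfolding OGMS_def by fastforce+
  moreover have "l t \<in> S"
    using OGMS_in_domain[OF assms(1,2,5)] assms(7) by simp
  ultimately show ?thesis
    using assms by (intro projected_subgradient_step)
qed

lemma OPMS_step:
  assumes "OPMS S \<alpha> T F l1 l" "\<alpha> > 0" "l1 \<in> S" "u \<in> S"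
    and "t \<in> {1..<T}" "convex_on S (F t)" "L-lipschitz_on S (F t)"
  shows "F t (l t) - F t u
    \<le> \<alpha> * L\<^sup>2 / 2 + ((norm (u - l t))\<^sup>2 - (norm (u - l (Suc t)))\<^sup>2) / (2 * \<alpha>)"
proof -
  have "Suc t \<in> {2..T}"
    using assms(5) by auto
  then have "is_arg_min (\<lambda>x. F t x + (norm (x - l t))\<^sup>2 / (2 * \<alpha>)) (\<lambda>x. x \<in> S) (l (Suc t))"
    using assms(1) unfolding OPMS_def by fastforce
  moreover have "l t \<in> S"
    using OPMS_in_domain[OF assms(1,3)] assms(5) by simp
  ultimately show ?thesis
    using assms by (intro proximal_step)
qed

section \<open>Summation over the tasks\<close>

lemma regret_le_of_steps:
  fixes l :: "nat \<Rightarrow> 'a::real_normed_vector"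
  assumes "T \<ge> 1" "\<alpha> > 0" "l T \<in> S" "u \<in> S" "L-lipschitz_on S (F T)"
    and step: "\<And>t. t \<in> {1..<T} \<Longrightarrow> F t (l t) - F t u
      \<le> \<alpha> * L\<^sup>2 / 2 + ((norm (u - l t))\<^sup>2 - (norm (u - l (Suc t)))\<^sup>2) / (2 * \<alpha>)"
  shows "(\<Sum>t=1..T. F t (l t))
    \<le> (\<Sum>t=1..T. F t u) + \<alpha> * real T * L\<^sup>2 / 2 + (norm (u - l 1))\<^sup>2 / (2 * \<alpha>)"
proof -
  have last: "F T (l T) - F T u \<le> \<alpha> * L\<^sup>2 / 2 + (norm (u - l T))\<^sup>2 / (2 * \<alpha>)"
    using lipschitz_on_diff_le[OF assms(5,3,4)] linear_le_quadratic[OF \<open>\<alpha> > 0\<close>, of L "norm (u - l T)"]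
    by (simp add: norm_minus_commute)
  define a where "a = (\<lambda>t. (norm (u - l t))\<^sup>2 / (2 * \<alpha>))"
  have "(\<Sum>t=1..<T. F t (l t) - F t u) \<le> (\<Sum>t=1..<T. \<alpha> * L\<^sup>2 / 2 - (a (Suc t) - a t))"
    unfolding a_def using step by (intro sum_mono) (simp add: diff_divide_distrib algebra_simps)
  also have "\<dots> = real (T - 1) * (\<alpha> * L\<^sup>2 / 2) - (\<Sum>t=1..<T. a (Suc t) - a t)"
    by (subst sum_subtractf) simp
  also have "(\<Sum>t=1..<T. a (Suc t) - a t) = a T - a 1"
    using \<open>T \<ge> 1\<close> by (rule sum_Suc_diff')
  \<comment> \<open>The \<open>T - 1\<close> updates and the last task contribute \<open>T\<close>
    copies of the constant, and \<open>a T\<close> cancels against the distance term in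
    \<open>last\<close>.\<close>
  finally have "(\<Sum>t=1..<T. F t (l t) - F t u) + (F T (l T) - F T u)
    \<le> real T * (\<alpha> * L\<^sup>2 / 2) + (norm (u - l 1))\<^sup>2 / (2 * \<alpha>)"
    using last \<open>T \<ge> 1\<close> unfolding a_def by (simp add: of_nat_diff algebra_simps diff_divide_distrib)
  moreover have "{1..T} = insert T {1..<T}"
    using \<open>T \<ge> 1\<close> by auto
  ultimately show ?thesis
    by (simp add: sum_subtractf algebra_simps)
qed

text \<open>At relative frontier points of \<open>\<Lambda>\<close> a normal vector can make a
  subgradient longer than \<open>L\<close>, so the OGMS alternative bounds the chosen subgradients
  there.\<close>

theorem proposition3p1:
  fixes T n :: nat
    and \<Theta> \<Theta>0 :: "(real ^ 'd) set"
    and \<Lambda> :: "(real ^ 'p) set"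
    and loss :: "nat \<Rightarrow> nat \<Rightarrow> real ^ 'd \<Rightarrow> real"
    and B :: "real ^ 'd \<Rightarrow> real ^ 'p \<Rightarrow> real"
    and \<theta> :: "nat \<Rightarrow> nat \<Rightarrow> real ^ 'p \<Rightarrow> real ^ 'd"
    and L \<alpha> :: real
    and l1 :: "real ^ 'p"
    and l g :: "nat \<Rightarrow> real ^ 'p"
  assumes "T \<ge> 1" and "n \<ge> 1"
    and "closed \<Lambda>" and "convex \<Lambda>"
    and loss_convex: "\<And>t i. t \<in> {1..T} \<Longrightarrow> i \<in> {1..n} \<Longrightarrow> convex_fun_on \<Theta> (loss t i)"
    and decisions: "\<And>t i lam. t \<in> {1..T} \<Longrightarrow> i \<in> {1..n} \<Longrightarrow> lam \<in> \<Lambda> \<Longrightarrow> \<theta> t i lam \<in> \<Theta>"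
    and "\<Theta>0 \<subseteq> \<Theta>"
    and meta_loss_finite: "\<Theta>0 \<noteq> {}"
      "\<And>t lam. t \<in> {1..T} \<Longrightarrow> lam \<in> \<Lambda> \<Longrightarrow>
         bdd_below ((\<lambda>\<theta>'. (\<Sum>i=1..n. loss t i \<theta>') + B \<theta>' lam) ` \<Theta>0)"
    and within_task: "\<And>t lam. t \<in> {1..T} \<Longrightarrow> lam \<in> \<Lambda> \<Longrightarrow>
         (\<Sum>i=1..n. loss t i (\<theta> t i lam)) \<le> meta_loss loss B \<Theta>0 n t lam"
    and lipschitz: "\<And>t. t \<in> {1..T} \<Longrightarrow> L-lipschitz_on \<Lambda> (meta_loss loss B \<Theta>0 n t)"
    and meta_convex: "\<And>t. t \<in> {1..T} \<Longrightarrow> convex_on \<Lambda> (meta_loss loss B \<Theta>0 n t)"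
    and "\<alpha> > 0" and "l1 \<in> \<Lambda>"
    and strategy:
      "(OGMS \<Lambda> \<alpha> T (meta_loss loss B \<Theta>0 n) g l1 l \<and>
          (\<forall>t\<in>{1..<T}. l t \<in> rel_frontier \<Lambda> \<longrightarrow> norm (g t) \<le> L)) \<or>
       OPMS \<Lambda> \<alpha> T (meta_loss loss B \<Theta>0 n) l1 l"
  shows "(\<Sum>t=1..T. \<Sum>i=1..n. loss t i (\<theta> t i (l t)))
    \<le> (INF lam\<in>\<Lambda>. (\<Sum>t=1..T. meta_loss loss B \<Theta>0 n t lam)
          + \<alpha> * real T * L\<^sup>2 / 2 + (norm (lam - l1))\<^sup>2 / (2 * \<alpha>))"
proof (rule cINF_greatest)
  show "\<Lambda> \<noteq> {}"
    using \<open>l1 \<in> \<Lambda>\<close> by blast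
next
  fix u
  assume u: "u \<in> \<Lambda>"
  let ?F = "meta_loss loss B \<Theta>0 n"
  have in_domain: "l t \<in> \<Lambda>" if "t \<in> {1..T}" for t
    using strategy that OGMS_in_domain[OF _ \<open>closed \<Lambda>\<close> \<open>l1 \<in> \<Lambda>\<close>] OPMS_in_domain[OF _ \<open>l1 \<in> \<Lambda>\<close>]
    by blast
  have step: "?F t (l t) - ?F t u
      \<le> \<alpha> * L\<^sup>2 / 2 + ((norm (u - l t))\<^sup>2 - (norm (u - l (Suc t)))\<^sup>2) / (2 * \<alpha>)"
    if t: "t \<in> {1..<T}" for t
  proof -
    have t': "t \<in> {1..T}"
      using t by simp
    from strategy show ?thesis
    proof (elim disjE conjE)
      assume ogms: "OGMS \<Lambda> \<alpha> T ?F g l1 l"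
        and bound: "\<forall>t\<in>{1..<T}. l t \<in> rel_frontier \<Lambda> \<longrightarrow> norm (g t) \<le> L"
      show ?thesis
        using OGMS_step[OF ogms assms(3,4) \<open>\<alpha> > 0\<close> \<open>l1 \<in> \<Lambda>\<close> u t lipschitz[OF t']] bound t by blast
    next
      assume opms: "OPMS \<Lambda> \<alpha> T ?F l1 l"
      show ?thesis
        by (rule OPMS_step[OF opms \<open>\<alpha> > 0\<close> \<open>l1 \<in> \<Lambda>\<close> u t meta_convex[OF t'] lipschitz[OF t']])
    qed
  qed
  have "l 1 = l1"
    using strategy by (auto simp: OGMS_def OPMS_def)
  \<comment> \<open>The within-task guarantee is applied at \<open>l t\<close>, which lies in
    \<open>\<Lambda>\<close>; what remains is the regret of the meta-losses against
    \<open>u\<close>.\<close>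
  have "(\<Sum>t=1..T. \<Sum>i=1..n. loss t i (\<theta> t i (l t))) \<le> (\<Sum>t=1..T. ?F t (l t))"
    using in_domain by (intro sum_mono within_task)
  also have "\<dots> \<le> (\<Sum>t=1..T. ?F t u) + \<alpha> * real T * L\<^sup>2 / 2 + (norm (u - l 1))\<^sup>2 / (2 * \<alpha>)"
    using \<open>T \<ge> 1\<close> \<open>\<alpha> > 0\<close> u in_domain lipschitz step by (intro regret_le_of_steps[where S = \<Lambda>]) auto
  finally show "(\<Sum>t=1..T. \<Sum>i=1..n. loss t i (\<theta> t i (l t)))
      \<le> (\<Sum>t=1..T. ?F t u) + \<alpha> * real T * L\<^sup>2 / 2 + (norm (u - l1))\<^sup>2 / (2 * \<alpha>)"
    unfolding \<open>l 1 = l1\<close> .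
qed

end
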